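(* There exists a constant $b_4>0$ such that the following holds. Let $\mathcal{M}$ denote a finite set of distinct positive integers, and write $N = \# \mathcal{M}$. Let $\omega(\cdot)$ denote the number of distinct prime factors of an integer. Then $$ \sum_{m,n \in \mathcal{M}} \frac{(m,n)^{1/2}}{(mn)^{1/4}} 2^{\omega(mn/(m,n)^2)} \leq N^{3/2} (\log N)^{b_4}, $$ provided that $N$ is sufficiently large.
   Context: $(m,n)$ denotes the greatest common divisor of $m$ and $n$. "Sufficiently large" means larger than some absolute constant. *)

theory Defs
  imports Complex_Main "HOL-Computational_Algebra.Primes"
begin

definition primeomega :: "nat \<Rightarrow> nat" where
  "primeomega n = card (prime_factors n)"

end

theory Submission
  imports Defs
begin

text \<open>
  Write \<open>Q = m n / (m,n)\<^sup>2\<close>. Then \<open>v\<^sub>p(Q) = \<bar>v\<^sub>p(m) - v\<^sub>p(n)\<bar>\<close> for every prime \<open>p\<close>, and the summand is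
  \<open>Q powr (-1/4) * 2 ^ \<omega>(Q)\<close>. It is therefore a product over the primes of the local kernels
  \<open>k\<^sub>p(i, j)\<close>, evaluated at \<open>i = v\<^sub>p(m)\<close> and \<open>j = v\<^sub>p(n)\<close>, where \<open>k\<^sub>p(i, i) = 1\<close> and
  \<open>k\<^sub>p(i, j) = 2 * p powr (-\<bar>i - j\<bar>/4)\<close> off the diagonal.

  The exponent \<open>3/2\<close> of \<open>N\<close> is twice \<open>3/4\<close>, which suggests to measure kernels as bilinear
  forms on \<open>\<ell>\<^sup>p\<close> with \<open>p = 4/3\<close>: the indicator function of \<open>M\<close> has norm \<open>N powr (3/4)\<close> there.
  Because both arguments carry the same norm, the operator norm of a tensor product of nonnegative
  kernels is at most the product of the norms (\<open>kernel_bound_prod\<close>), so everything reduces to one prime.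
  There the norm is \<open>1 + O(1/p)\<close> (\<open>power_kernel_bound\<close>). This is better than the first order term
  \<open>p powr (-1/4)\<close> of the kernel suggests: two weights that both concentrate at the same exponent up to
  a mass \<open>\<epsilon>\<close> lose about \<open>\<epsilon>\<close> on the diagonal and gain only about
  \<open>\<epsilon> powr (3/4) * p powr (-1/4)\<close> off it, and the difference is at most \<open>O(1/p)\<close> for every \<open>\<epsilon>\<close>.

  It remains to limit the primes. A pair with \<open>Q \<ge> N\<^sup>4\<close> contributes \<open>O(N powr (-1/2))\<close>, because
  \<open>2 ^ \<omega>(Q) = O(Q powr (1/8))\<close>, and there are only \<open>N\<^sup>2\<close> pairs. In the other pairs only primes below
  about \<open>N\<^sup>4\<close> occur in \<open>Q\<close>, so that at all larger primes the kernel may be replaced by equality of the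
  exponents, which has norm 1 (\<open>exponent_kernel\<close>). The product of \<open>1 + C/p\<close> over the primes
  \<open>p \<le> 2 ^ k\<close> is a power of \<open>k\<close> up to a constant, by the elementary upper bound of Chebyshev
  for the number of primes in a dyadic interval, and \<open>k\<close> is of order \<open>log N\<close>.
\<close>

section \<open>Bilinear forms on three-quarter powers\<close>

text \<open>
  The norm of \<open>K\<close> as a bilinear form on \<open>\<ell>\<^sup>p\<close> with \<open>p = 4/3\<close> is at most \<open>C\<close>. The vectors are
  written as \<open>3/4\<close>-th powers of weights: then the norms are total masses, and the mass of a fibre can
  serve as a weight on the base.
\<close>
definition kernel_bound :: "'a set \<Rightarrow> ('a \<Rightarrow> 'a \<Rightarrow> real) \<Rightarrow> real \<Rightarrow> bool" where
  "kernel_bound I K C \<longleftrightarrow>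
     (\<forall>\<alpha> \<beta>. (\<forall>i\<in>I. 0 \<le> \<alpha> i) \<longrightarrow> (\<forall>i\<in>I. 0 \<le> \<beta> i) \<longrightarrow>
        (\<Sum>i\<in>I. \<Sum>j\<in>I. (\<alpha> i * \<beta> j) powr (3/4) * K i j)
          \<le> C * (sum \<alpha> I * sum \<beta> I) powr (3/4))"

lemma kernel_boundD:
  assumes "kernel_bound I K C" "\<And>i. i \<in> I \<Longrightarrow> 0 \<le> \<alpha> i" "\<And>i. i \<in> I \<Longrightarrow> 0 \<le> \<beta> i"
  shows "(\<Sum>i\<in>I. \<Sum>j\<in>I. (\<alpha> i * \<beta> j) powr (3/4) * K i j)
          \<le> C * (sum \<alpha> I * sum \<beta> I) powr (3/4)"
  using assms unfolding kernel_bound_def by blast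

text \<open>
  Bound the inner form on each pair of fibres first. What appears is \<open>C2\<close> times the \<open>3/4\<close>-th power
  of the product of the two fibre masses, which is exactly the shape to which the outer bound applies.
\<close>
lemma kernel_bound_prod:
  fixes K1 :: "'a \<Rightarrow> 'a \<Rightarrow> real" and K2 :: "'b \<Rightarrow> 'b \<Rightarrow> real"
  assumes 1: "kernel_bound I K1 C1" and 2: "kernel_bound J K2 C2"
    and nonneg: "\<And>i i'. 0 \<le> K1 i i'" "0 \<le> C2"
  shows "kernel_bound (I \<times> J) (\<lambda>(i, j) (i', j'). K1 i i' * K2 j j') (C1 * C2)"
  unfolding kernel_bound_def
proof (intro allI impI)
  fix \<alpha> \<beta> :: "'a \<times> 'b \<Rightarrow> real"
  assume \<alpha>: "\<forall>x\<in>I \<times> J. 0 \<le> \<alpha> x" and \<beta>: "\<forall>x\<in>I \<times> J. 0 \<le> \<beta> x"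
  define A where "A i = (\<Sum>j\<in>J. \<alpha> (i, j))" for i
  define B where "B i = (\<Sum>j\<in>J. \<beta> (i, j))" for i
  have AB: "0 \<le> A i" "0 \<le> B i" if "i \<in> I" for i
    using that \<alpha> \<beta> unfolding A_def B_def by (auto intro!: sum_nonneg)
  have "(\<Sum>x\<in>I \<times> J. \<Sum>y\<in>I \<times> J. (\<alpha> x * \<beta> y) powr (3/4) *
           (case x of (i, j) \<Rightarrow> \<lambda>(i', j'). K1 i i' * K2 j j') y)
      = (\<Sum>i\<in>I. \<Sum>j\<in>J. \<Sum>i'\<in>I. \<Sum>j'\<in>J. (\<alpha> (i, j) * \<beta> (i', j')) powr (3/4) * (K1 i i' * K2 j j'))"
  proof -
    have Sigma: "(\<Sum>x\<in>I \<times> J. g x) = (\<Sum>i\<in>I. \<Sum>j\<in>J. g (i, j))" for g :: "_ \<Rightarrow> real"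
      by (simp add: sum.cartesian_product)
    show ?thesis by (simp add: Sigma)
  qed
  also have "\<dots> = (\<Sum>i\<in>I. \<Sum>i'\<in>I. K1 i i' * (\<Sum>j\<in>J. \<Sum>j'\<in>J. (\<alpha> (i, j) * \<beta> (i', j')) powr (3/4) * K2 j j'))"
    by (subst sum.swap) (simp add: sum_distrib_left mult_ac)
  also have "\<dots> \<le> (\<Sum>i\<in>I. \<Sum>i'\<in>I. K1 i i' * (C2 * (A i * B i') powr (3/4)))"
    unfolding A_def B_def using \<alpha> \<beta>
    by (intro sum_mono mult_left_mono kernel_boundD[OF 2] nonneg) auto
  also have "\<dots> = C2 * (\<Sum>i\<in>I. \<Sum>i'\<in>I. (A i * B i') powr (3/4) * K1 i i')"
    by (simp add: sum_distrib_left mult_ac)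
  also have "\<dots> \<le> C2 * (C1 * (sum A I * sum B I) powr (3/4))"
    by (intro mult_left_mono kernel_boundD[OF 1] nonneg AB)
  also have "\<dots> = C1 * C2 * (sum \<alpha> (I \<times> J) * sum \<beta> (I \<times> J)) powr (3/4)"
    by (simp add: A_def B_def sum.cartesian_product)
  finally show "(\<Sum>x\<in>I \<times> J. \<Sum>y\<in>I \<times> J. (\<alpha> x * \<beta> y) powr (3/4) *
           (case x of (i, j) \<Rightarrow> \<lambda>(i', j'). K1 i i' * K2 j j') y)
     \<le> C1 * C2 * (sum \<alpha> (I \<times> J) * sum \<beta> (I \<times> J)) powr (3/4)" .
qed

text \<open>
  Weights on \<open>I\<close> extend by zero along the injection. Hence a bound on a product set also covers
  subsets of it which are not products.
\<close>
lemma kernel_bound_pullback: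
  fixes K :: "'a \<Rightarrow> 'a \<Rightarrow> real"
  assumes L: "kernel_bound J L C" and fin: "finite J"
    and inj: "inj_on f I" and sub: "f ` I \<subseteq> J"
    and KL: "\<And>i i'. i \<in> I \<Longrightarrow> i' \<in> I \<Longrightarrow> K i i' = L (f i) (f i')"
  shows "kernel_bound I K C"
  unfolding kernel_bound_def
proof (intro allI impI)
  fix \<alpha> \<beta> :: "'a \<Rightarrow> real"
  assume \<alpha>: "\<forall>i\<in>I. 0 \<le> \<alpha> i" and \<beta>: "\<forall>i\<in>I. 0 \<le> \<beta> i"
  define ext where "ext w j = (if j \<in> f ` I then w (the_inv_into I f j) else 0)" for w :: "'a \<Rightarrow> real" and j
  have ext_f: "ext w (f i) = w i" if "i \<in> I" for w i
    using that inj by (simp add: ext_def the_inv_into_f_f)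
  have ext_nonneg: "0 \<le> ext w j" if "\<forall>i\<in>I. 0 \<le> w i" for w j
    using that inj by (auto simp: ext_def the_inv_into_f_f)
  have sum_ext: "(\<Sum>j\<in>J. g j) = (\<Sum>i\<in>I. g (f i))" if "\<And>j. j \<notin> f ` I \<Longrightarrow> g j = 0" for g :: "_ \<Rightarrow> real"
  proof -
    have "(\<Sum>j\<in>J. g j) = (\<Sum>j\<in>f ` I. g j)"
      using fin sub that by (intro sum.mono_neutral_right) auto
    also have "\<dots> = (\<Sum>i\<in>I. g (f i))" by (simp add: sum.reindex[OF inj])
    finally show ?thesis .
  qed
  have "(\<Sum>i\<in>I. \<Sum>i'\<in>I. (\<alpha> i * \<beta> i') powr (3/4) * K i i')
      = (\<Sum>i\<in>I. \<Sum>i'\<in>I. (ext \<alpha> (f i) * ext \<beta> (f i')) powr (3/4) * L (f i) (f i'))"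
    by (simp add: ext_f KL)
  also have "\<dots> = (\<Sum>j\<in>J. \<Sum>j'\<in>J. (ext \<alpha> j * ext \<beta> j') powr (3/4) * L j j')"
    by (subst sum_ext, simp add: ext_def, rule sum.cong[OF refl], subst sum_ext) (simp_all add: ext_def)
  also have "\<dots> \<le> C * (sum (ext \<alpha>) J * sum (ext \<beta>) J) powr (3/4)"
    by (rule kernel_boundD[OF L]) (use ext_nonneg \<alpha> \<beta> in auto)
  also have "sum (ext \<alpha>) J = sum \<alpha> I"
    by (subst sum_ext) (simp_all add: ext_f, simp add: ext_def)
  also have "sum (ext \<beta>) J = sum \<beta> I"
    by (subst sum_ext) (simp_all add: ext_f, simp add: ext_def)
  finally show "(\<Sum>i\<in>I. \<Sum>i'\<in>I. (\<alpha> i * \<beta> i') powr (3/4) * K i i') \<le> C * (sum \<alpha> I * sum \<beta> I) powr (3/4)" .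
qed

text \<open>
  For weights bounded by 1 the power \<open>3/4\<close> may be lowered to \<open>1/2\<close>, and then the geometric mean is at
  most the arithmetic mean.
\<close>
lemma three_quarters_le_mean:
  fixes x y :: real
  assumes "0 \<le> x" "x \<le> 1" "0 \<le> y" "y \<le> 1"
  shows "(x * y) powr (3/4) \<le> (x + y) / 2"
proof -
  have "(x * y) powr (3/4) \<le> (x * y) powr (1/2)"
    using assms by (intro powr_mono') (auto intro: mult_le_one)
  also have "\<dots> = sqrt (x * y)" using assms by (simp add: powr_half_sqrt)
  also have "\<dots> \<le> (x + y) / 2" using assms by (intro arith_geo_mean_sqrt)
  finally show ?thesis .
qed

text \<open>
  Both sides are homogeneous in \<open>\<alpha>\<close> and in \<open>\<beta>\<close>, so total mass 1 is the only case.
\<close>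
lemma kernel_bound_normalized:
  assumes C: "0 \<le> C" and fin: "finite I"
    and norm: "\<And>\<alpha> \<beta>. (\<And>i. i \<in> I \<Longrightarrow> 0 \<le> \<alpha> i) \<Longrightarrow> (\<And>i. i \<in> I \<Longrightarrow> 0 \<le> \<beta> i) \<Longrightarrow>
       sum \<alpha> I = 1 \<Longrightarrow> sum \<beta> I = 1 \<Longrightarrow> (\<Sum>i\<in>I. \<Sum>j\<in>I. (\<alpha> i * \<beta> j) powr (3/4) * K i j) \<le> C"
  shows "kernel_bound I K C"
  unfolding kernel_bound_def
proof (intro allI impI)
  fix \<alpha> \<beta> :: "'a \<Rightarrow> real"
  assume \<alpha>: "\<forall>i\<in>I. 0 \<le> \<alpha> i" and \<beta>: "\<forall>i\<in>I. 0 \<le> \<beta> i"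
  define s where "s = sum \<alpha> I"
  define t where "t = sum \<beta> I"
  show "(\<Sum>i\<in>I. \<Sum>j\<in>I. (\<alpha> i * \<beta> j) powr (3/4) * K i j) \<le> C * (sum \<alpha> I * sum \<beta> I) powr (3/4)"
  proof (cases "s = 0 \<or> t = 0")
    case True
    then have "\<alpha> i * \<beta> j = 0" if "i \<in> I" "j \<in> I" for i j
      using \<alpha> \<beta> fin that by (auto simp: s_def t_def sum_nonneg_eq_0_iff)
    then have "(\<Sum>i\<in>I. \<Sum>j\<in>I. (\<alpha> i * \<beta> j) powr (3/4) * K i j) = 0"
      by (intro sum.neutral ballI) auto
    then show ?thesis using C by simp
  next
    case False
    have st: "0 < s" "0 < t"
      using False \<alpha> \<beta> sum_nonneg[of I \<alpha>] sum_nonneg[of I \<beta>] unfolding s_def t_def by auto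
    have "(\<Sum>i\<in>I. \<Sum>j\<in>I. (\<alpha> i * \<beta> j) powr (3/4) * K i j)
      = (s * t) powr (3/4) * (\<Sum>i\<in>I. \<Sum>j\<in>I. (\<alpha> i / s * (\<beta> j / t)) powr (3/4) * K i j)"
      unfolding sum_distrib_left
    proof (intro sum.cong refl)
      fix i j assume "i \<in> I" "j \<in> I"
      have "\<alpha> i * \<beta> j = s * t * (\<alpha> i / s * (\<beta> j / t))" using st by simp
      then have "(\<alpha> i * \<beta> j) powr (3/4) = (s * t) powr (3/4) * (\<alpha> i / s * (\<beta> j / t)) powr (3/4)"
        using st \<alpha> \<beta> \<open>i \<in> I\<close> \<open>j \<in> I\<close> by (metis powr_mult mult_nonneg_nonneg less_imp_le divide_nonneg_nonneg)
      then show "(\<alpha> i * \<beta> j) powr (3/4) * K i j =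
          (s * t) powr (3/4) * ((\<alpha> i / s * (\<beta> j / t)) powr (3/4) * K i j)" by simp
    qed
    also have "\<dots> \<le> (s * t) powr (3/4) * C"
      using st \<alpha> \<beta> by (intro mult_left_mono norm)
        (auto simp: sum_divide_distrib[symmetric] s_def[symmetric] t_def[symmetric])
    finally show ?thesis by (simp add: s_def t_def mult.commute)
  qed
qed

lemma kernel_bound_diagonal:
  assumes "finite I"
  shows "kernel_bound I (\<lambda>i j. if i = j then 1 else 0) 1"
proof (rule kernel_bound_normalized)
  fix \<alpha> \<beta> :: "'a \<Rightarrow> real"
  assume nn: "\<And>i. i \<in> I \<Longrightarrow> 0 \<le> \<alpha> i" "\<And>i. i \<in> I \<Longrightarrow> 0 \<le> \<beta> i" and s: "sum \<alpha> I = 1" "sum \<beta> I = 1"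
  have le1: "\<alpha> i \<le> 1" "\<beta> i \<le> 1" if "i \<in> I" for i
    using member_le_sum[of i I \<alpha>] member_le_sum[of i I \<beta>] that nn assms s by auto
  have "(\<Sum>i\<in>I. \<Sum>j\<in>I. (\<alpha> i * \<beta> j) powr (3/4) * (if i = j then 1 else 0))
      = (\<Sum>i\<in>I. (\<alpha> i * \<beta> i) powr (3/4))"
    using assms by (simp add: if_distrib[of "\<lambda>c. _ * c"] sum.delta cong: if_cong)
  also have "\<dots> \<le> (\<Sum>i\<in>I. (\<alpha> i + \<beta> i) / 2)"
    using nn le1 by (intro sum_mono three_quarters_le_mean) auto
  also have "\<dots> = 1" using s by (simp add: sum_divide_distrib[symmetric] sum.distrib)
  finally show "(\<Sum>i\<in>I. \<Sum>j\<in>I. (\<alpha> i * \<beta> j) powr (3/4) * (if i = j then 1 else 0)) \<le> 1" .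
qed (use assms in auto)

section \<open>One prime\<close>

text \<open>
  The term \<open>(i - j) + (j - i)\<close> is the distance of \<open>i\<close> and \<open>j\<close>: one of the truncated differences
  vanishes. The factor 2 is the contribution of a prime factor to \<open>2 ^ \<omega>(Q)\<close>.
\<close>
definition power_kernel :: "real \<Rightarrow> nat \<Rightarrow> nat \<Rightarrow> real" where
  "power_kernel q i j = (if i = j then 1 else 2 * q ^ ((i - j) + (j - i)))"

lemma sum_powers_le:
  fixes q :: real
  assumes q: "0 \<le> q" "q < 1" and "finite D" "0 \<notin> D"
  shows "(\<Sum>d\<in>D. q ^ d) \<le> q / (1 - q)"
proof -
  have "(\<Sum>d\<in>D. q ^ d) \<le> (\<Sum>d\<in>{..Max (insert 0 D)} - {0}. q ^ d)"
    using assms by (intro sum_mono2) (auto intro: Max_ge)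
  also have "\<dots> = (\<Sum>d\<le>Max (insert 0 D). q ^ d) - 1"
    by (simp add: sum_diff1)
  also have "\<dots> \<le> 1 / (1 - q) - 1"
  proof -
    have "(\<Sum>d<Suc (Max (insert 0 D)). q ^ d) \<le> (\<Sum>d. q ^ d)"
      using q by (intro sum_le_suminf summable_geometric) auto
    then show ?thesis using q by (simp add: suminf_geometric lessThan_Suc_atMost)
  qed
  also have "\<dots> = q / (1 - q)" using q by (simp add: field_simps)
  finally show ?thesis .
qed

lemma row_sum_le:
  fixes q :: real
  assumes q: "0 \<le> q" "q < 1" and fin: "finite S"
  shows "(\<Sum>j\<in>S - {i}. q ^ ((i - j) + (j - i))) \<le> 2 * q / (1 - q)"
proof -
  have split: "S - {i} = (S \<inter> {..<i}) \<union> (S \<inter> {i<..})" by auto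
  have "(\<Sum>j\<in>S - {i}. q ^ ((i - j) + (j - i)))
      = (\<Sum>j\<in>S \<inter> {..<i}. q ^ ((i - j) + (j - i))) + (\<Sum>j\<in>S \<inter> {i<..}. q ^ ((i - j) + (j - i)))"
    unfolding split using fin by (intro sum.union_disjoint) auto
  also have "(\<Sum>j\<in>S \<inter> {..<i}. q ^ ((i - j) + (j - i))) = (\<Sum>d\<in>(\<lambda>j. i - j) ` (S \<inter> {..<i}). q ^ d)"
    by (subst sum.reindex) (auto intro!: inj_onI)
  also have "\<dots> \<le> q / (1 - q)" using fin by (intro sum_powers_le q) auto
  also have "(\<Sum>j\<in>S \<inter> {i<..}. q ^ ((i - j) + (j - i))) = (\<Sum>d\<in>(\<lambda>j. j - i) ` (S \<inter> {i<..}). q ^ d)"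
    by (subst sum.reindex) (auto intro!: inj_onI)
  also have "\<dots> \<le> q / (1 - q)" using fin by (intro sum_powers_le q) auto
  finally show ?thesis by simp
qed

text \<open>
  After \<open>(\<alpha>\<^sub>i \<beta>\<^sub>j) powr (3/4) \<le> (\<alpha>\<^sub>i + \<beta>\<^sub>j)/2\<close> only the row sums of the kernel matter. This is linear in
  the masses and of first order in \<open>q\<close>, which is good enough where \<open>q\<close> is not small and where the
  masses themselves are to be absorbed.
\<close>
lemma off_diagonal_sum_le:
  fixes q :: real
  assumes q: "0 \<le> q" "q < 1" and fin: "finite S"
    and nn: "\<And>i. i \<in> S \<Longrightarrow> 0 \<le> \<alpha> i" "\<And>i. i \<in> S \<Longrightarrow> 0 \<le> \<beta> i"
    and le1: "\<And>i. i \<in> S \<Longrightarrow> \<alpha> i \<le> 1" "\<And>i. i \<in> S \<Longrightarrow> \<beta> i \<le> 1"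
  shows "(\<Sum>i\<in>S. \<Sum>j\<in>S - {i}. (\<alpha> i * \<beta> j) powr (3/4) * power_kernel q i j)
          \<le> 2 * q / (1 - q) * (sum \<alpha> S + sum \<beta> S)"
proof -
  define w where "w i j = q ^ ((i - j) + (j - i))" for i j :: nat
  have row: "(\<Sum>j\<in>S - {i}. w i j) \<le> 2 * q / (1 - q)" for i
    unfolding w_def by (rule row_sum_le[OF q fin])
  have w_sym: "w i j = w j i" for i j by (simp add: w_def add.commute)
  have w_nonneg: "0 \<le> w i j" for i j using q by (simp add: w_def)
  have swap: "(\<Sum>i\<in>S. \<Sum>j\<in>S - {i}. w i j * \<beta> j) = (\<Sum>j\<in>S. \<Sum>i\<in>S - {j}. w j i * \<beta> j)"
  proof -
    have eq: "(\<Sum>j\<in>S - {i}. g j) = (\<Sum>j\<in>S. if i = j then 0 else g j)" for i and g :: "nat \<Rightarrow> real"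
      using fin by (intro sum.mono_neutral_cong_left) auto
    show ?thesis unfolding eq by (subst sum.swap) (auto intro!: sum.cong simp: w_sym)
  qed
  have "(\<Sum>i\<in>S. \<Sum>j\<in>S - {i}. (\<alpha> i * \<beta> j) powr (3/4) * power_kernel q i j)
      \<le> (\<Sum>i\<in>S. \<Sum>j\<in>S - {i}. w i j * \<alpha> i + w i j * \<beta> j)"
  proof (intro sum_mono)
    fix i j assume "i \<in> S" "j \<in> S - {i}"
    then have "(\<alpha> i * \<beta> j) powr (3/4) * (2 * w i j) \<le> (\<alpha> i + \<beta> j) / 2 * (2 * w i j)"
      using nn le1 w_nonneg by (intro mult_right_mono three_quarters_le_mean) auto
    then show "(\<alpha> i * \<beta> j) powr (3/4) * power_kernel q i j \<le> w i j * \<alpha> i + w i j * \<beta> j"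
      using \<open>j \<in> S - {i}\<close> by (auto simp: power_kernel_def w_def algebra_simps)
  qed
  also have "\<dots> = (\<Sum>i\<in>S. (\<Sum>j\<in>S - {i}. w i j) * \<alpha> i) + (\<Sum>j\<in>S. (\<Sum>i\<in>S - {j}. w j i) * \<beta> j)"
    by (simp add: sum.distrib swap sum_distrib_right)
  also have "\<dots> \<le> (\<Sum>i\<in>S. 2 * q / (1 - q) * \<alpha> i) + (\<Sum>j\<in>S. 2 * q / (1 - q) * \<beta> j)"
    by (intro add_mono sum_mono mult_right_mono row nn)
  also have "\<dots> = 2 * q / (1 - q) * (sum \<alpha> S + sum \<beta> S)"
    by (simp add: sum_distrib_left distrib_left)
  finally show ?thesis .
qed

text \<open>
  For \<open>q\<close> bounded away from 0 and from 1 the norm is bounded, and any bound can be written as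
  \<open>1 + C q\<^sup>4\<close> with a large \<open>C\<close>. The constant \<open>10\<^sup>9\<close> is just above \<open>23 * 81\<^sup>4\<close>.
\<close>
lemma power_kernel_bound_large:
  assumes q: "1/81 \<le> q" "q \<le> 17/20" and fin: "finite S"
  shows "kernel_bound S (power_kernel q) (1 + 10^9 * q^4)"
proof (rule kernel_bound_normalized)
  fix \<alpha> \<beta> :: "nat \<Rightarrow> real"
  assume nn: "\<And>i. i \<in> S \<Longrightarrow> 0 \<le> \<alpha> i" "\<And>i. i \<in> S \<Longrightarrow> 0 \<le> \<beta> i" and s: "sum \<alpha> S = 1" "sum \<beta> S = 1"
  have le1: "\<alpha> i \<le> 1" "\<beta> i \<le> 1" if "i \<in> S" for i
    using member_le_sum[of i S \<alpha>] member_le_sum[of i S \<beta>] that nn fin s by auto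
  have "(\<Sum>i\<in>S. \<Sum>j\<in>S. (\<alpha> i * \<beta> j) powr (3/4) * power_kernel q i j)
     = (\<Sum>i\<in>S. (\<alpha> i * \<beta> i) powr (3/4)) + (\<Sum>i\<in>S. \<Sum>j\<in>S - {i}. (\<alpha> i * \<beta> j) powr (3/4) * power_kernel q i j)"
    using fin by (simp add: sum.distrib[symmetric] sum.remove power_kernel_def)
  also have "\<dots> \<le> (\<Sum>i\<in>S. (\<alpha> i + \<beta> i) / 2) + 2 * q / (1 - q) * (sum \<alpha> S + sum \<beta> S)"
    using q by (intro add_mono sum_mono three_quarters_le_mean off_diagonal_sum_le nn le1 fin) auto
  also have "\<dots> = 1 + 4 * q / (1 - q)" using s by (simp add: sum_divide_distrib[symmetric] sum.distrib)
  also have "4 * q / (1 - q) \<le> 23" using q by (simp add: divide_simps)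
  also have "(23::real) \<le> 10^9 * (1/81)^4" by (simp add: power_divide)
  also have "\<dots> \<le> 10^9 * q^4" using q by (intro mult_left_mono power_mono) auto
  finally show "(\<Sum>i\<in>S. \<Sum>j\<in>S. (\<alpha> i * \<beta> j) powr (3/4) * power_kernel q i j) \<le> 1 + 10^9 * q^4" by simp
qed (use q fin in auto)

text \<open>
  This is the step that turns a contribution of order \<open>t\<close> into one of order \<open>t\<^sup>4\<close>, at the cost of a
  small multiple of the mass \<open>x\<close>.
\<close>
lemma young_three_quarters:
  fixes x t :: real
  assumes "0 \<le> x" "0 \<le> t" "0 < \<delta>"
  shows "x powr (3/4) * t \<le> \<delta> * x + t^4 / \<delta>^3"
proof -
  define y where "y = x powr (1/4)"
  have y: "0 \<le> y" "y^4 = x" "x powr (3/4) = y^3"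
    using assms unfolding y_def by (cases "x = 0"; simp add: powr_power)+
  show ?thesis
  proof (cases "t \<le> \<delta> * y")
    case True
    then have "y^3 * t \<le> y^3 * (\<delta> * y)" using y by (intro mult_left_mono) auto
    also have "\<dots> = \<delta> * x" unfolding y(2)[symmetric] by (simp add: power3_eq_cube power4_eq_xxxx)
    finally show ?thesis using y assms by (simp add: add_increasing2)
  next
    case False
    then have "y \<le> t / \<delta>" using assms by (simp add: field_simps)
    then have "y^3 * t \<le> (t / \<delta>)^3 * t" using y assms by (intro mult_right_mono power_mono) auto
    also have "\<dots> = t^4 / \<delta>^3" by (simp add: power_divide power3_eq_cube power4_eq_xxxx)
    finally show ?thesis using y assms by (simp add: add_increasing)
  qed
qed

text \<open>
  The gain over \<open>three_quarters_le_mean\<close> comes from the spare factor \<open>(x y) powr (1/4)\<close>, which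
  is at most \<open>(1/2) powr (1/4) < 17/20\<close>.
\<close>
lemma three_quarters_le_mean_half:
  fixes x y :: real
  assumes "0 \<le> x" "x \<le> 1/2" "0 \<le> y" "y \<le> 1"
  shows "(x * y) powr (3/4) \<le> 17/20 * ((x + y) / 2)"
proof -
  have xy: "x * y \<le> 1/2" using assms mult_mono[of x "1/2" y 1] by simp
  have "(x * y) powr (3/4) = (x * y) powr (1/4) * (x * y) powr (1/2)"
    by (simp add: powr_add[symmetric])
  also have "\<dots> \<le> ((17/20)^4) powr (1/4) * ((x + y) / 2)"
  proof (intro mult_mono)
    show "(x * y) powr (1/4) \<le> ((17/20)^4) powr (1/4)"
      using assms xy by (intro powr_mono2) (auto simp: power4_eq_xxxx)
    show "(x * y) powr (1/2) \<le> (x + y) / 2"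
      using assms arith_geo_mean_sqrt[of x y] by (simp add: powr_half_sqrt)
  qed auto
  also have "((17/20)^4) powr (1/4) = (17/20::real)"
  proof -
    have "((17/20)^4) powr (1/4) = ((17/20::real) powr 4) powr (1/4)" by (subst powr_numeral) auto
    also have "\<dots> = 17/20" by (simp add: powr_powr del: powr_numeral)
    finally show ?thesis .
  qed
  finally show ?thesis .
qed

text \<open>
  Let \<open>i0\<close> carry the largest weight of \<open>\<alpha>\<close>, and let \<open>e\<close> and \<open>f\<close> be the masses of \<open>\<alpha>\<close> and \<open>\<beta>\<close>
  away from \<open>i0\<close>. All other weights of \<open>\<alpha>\<close> are at most \<open>1/2\<close>, so the diagonal falls short
  of 1 by at least \<open>3/40 * (e + f)\<close>. This deficit pays for everything of first order: the entries
  away from the row and the column of \<open>i0\<close> cost at most \<open>1/40 * (e + f)\<close> as \<open>q\<close> is small,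
  and those in the row and the column cost, by \<open>young_three_quarters\<close>, at most \<open>2/40 * (e + f)\<close> plus
  a multiple of \<open>q\<^sup>4\<close>.
\<close>
lemma power_kernel_bound_small:
  assumes q: "0 \<le> q" "q \<le> 1/81" and fin: "finite S"
  shows "kernel_bound S (power_kernel q) (1 + 10^9 * q^4)"
proof (rule kernel_bound_normalized)
  fix \<alpha> \<beta> :: "nat \<Rightarrow> real"
  assume nn: "\<And>i. i \<in> S \<Longrightarrow> 0 \<le> \<alpha> i" "\<And>i. i \<in> S \<Longrightarrow> 0 \<le> \<beta> i" and s: "sum \<alpha> S = 1" "sum \<beta> S = 1"
  have le1: "\<alpha> i \<le> 1" "\<beta> i \<le> 1" if "i \<in> S" for i
    using member_le_sum[of i S \<alpha>] member_le_sum[of i S \<beta>] that nn fin s by auto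
  have "S \<noteq> {}" using s by auto
  then have "Max (\<alpha> ` S) \<in> \<alpha> ` S" using fin by (intro Max_in) auto
  then obtain i0 where "i0 \<in> S" "\<alpha> i0 = Max (\<alpha> ` S)" by auto
  then have i0: "i0 \<in> S" "\<And>i. i \<in> S \<Longrightarrow> \<alpha> i \<le> \<alpha> i0" using fin by auto
  define S' where "S' = S - {i0}"
  have S': "finite S'" "i0 \<notin> S'" "S = insert i0 S'" using fin i0 by (auto simp: S'_def)
  define e where "e = sum \<alpha> S'"
  define f where "f = sum \<beta> S'"
  have ef: "\<alpha> i0 = 1 - e" "\<beta> i0 = 1 - f" "0 \<le> e" "0 \<le> f"
    using s S' nn unfolding e_def f_def by (auto intro!: sum_nonneg)
  define T where "T i j = (\<alpha> i * \<beta> j) powr (3/4) * power_kernel q i j" for i j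
  \<comment> \<open>Either \<open>\<alpha> i0 \<le> 1/2\<close> bounds the other weights by maximality, or they share a mass below \<open>1/2\<close>.\<close>
  have half: "\<alpha> i \<le> 1/2" if "i \<in> S'" for i
  proof -
    have "\<alpha> i \<le> e" unfolding e_def using that S' nn by (intro member_le_sum) auto
    moreover have "\<alpha> i \<le> 1 - e" using i0(2)[of i] that S' ef by auto
    ultimately show ?thesis by simp
  qed
  have centre: "T i0 i0 \<le> 1 - (e + f) / 2"
  proof -
    have "(\<alpha> i0 * \<beta> i0) powr (3/4) \<le> (\<alpha> i0 + \<beta> i0) / 2"
      using nn le1 i0(1) by (intro three_quarters_le_mean) auto
    also have "\<dots> = 1 - (e + f) / 2" unfolding ef(1,2) by (simp add: field_simps)
    finally show ?thesis by (simp add: T_def power_kernel_def)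
  qed
  have diag: "(\<Sum>i\<in>S'. T i i) \<le> 17/20 * ((e + f) / 2)"
  proof -
    have "(\<Sum>i\<in>S'. T i i) \<le> (\<Sum>i\<in>S'. 17/20 * ((\<alpha> i + \<beta> i) / 2))"
    proof (rule sum_mono)
      fix i assume "i \<in> S'"
      then show "T i i \<le> 17/20 * ((\<alpha> i + \<beta> i) / 2)"
        using half nn le1 S' three_quarters_le_mean_half[of "\<alpha> i" "\<beta> i"]
        by (simp add: T_def power_kernel_def)
    qed
    then show ?thesis
      by (simp add: e_def f_def sum_distrib_left[symmetric] sum_divide_distrib[symmetric] sum.distrib)
  qed
  have off: "(\<Sum>i\<in>S'. \<Sum>j\<in>S' - {i}. T i j) \<le> 1/40 * (e + f)"
  proof -
    have "(\<Sum>i\<in>S'. \<Sum>j\<in>S' - {i}. T i j) \<le> 2 * q / (1 - q) * (e + f)"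
      unfolding T_def e_def f_def using q S' nn le1 by (intro off_diagonal_sum_le) auto
    also have "\<dots> \<le> 1/40 * (e + f)"
      using q ef by (intro mult_right_mono) (auto simp: divide_simps)
    finally show ?thesis .
  qed
  \<comment> \<open>The row and the column of \<open>i0\<close> at once: \<open>v\<close> is the weight at \<open>i0\<close> itself.\<close>
  have axis: "(\<Sum>i\<in>S'. (u i * v) powr (3/4) * (2 * q ^ ((i0 - i) + (i - i0))))
      \<le> 1/20 * sum u S' + 256001 * q^4"
    if u: "\<And>i. i \<in> S' \<Longrightarrow> 0 \<le> u i" and v: "0 \<le> v" "v \<le> 1" for u v
  proof -
    have "q^4 \<le> (1/81)^4" using q by (intro power_mono) auto
    then have q4: "q^4 \<le> 1 / 43046721" by (simp add: power_divide)
    have "(\<Sum>i\<in>S'. (u i * v) powr (3/4) * (2 * q ^ ((i0 - i) + (i - i0))))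
       \<le> (\<Sum>i\<in>S'. 1/20 * u i + 128000 * (q^4) ^ ((i0 - i) + (i - i0)))"
    proof (rule sum_mono)
      fix i assume i: "i \<in> S'"
      define t where "t = q ^ ((i0 - i) + (i - i0))"
      have t: "0 \<le> t" using q by (simp add: t_def)
      have "(u i * v) powr (3/4) * t \<le> u i powr (3/4) * t"
        using u[OF i] v t by (intro mult_right_mono powr_mono2) (auto intro: mult_left_le)
      also have "\<dots> \<le> 1/40 * u i + t^4 / (1/40)^3"
        using u[OF i] t by (intro young_three_quarters) auto
      finally have "(u i * v) powr (3/4) * t \<le> 1/40 * u i + 64000 * t^4" by (simp add: power_divide mult.commute)
      moreover have "t^4 = (q^4) ^ ((i0 - i) + (i - i0))"
        by (simp add: t_def power_mult[symmetric] mult.commute)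
      ultimately show "(u i * v) powr (3/4) * (2 * q ^ ((i0 - i) + (i - i0)))
          \<le> 1/20 * u i + 128000 * (q^4) ^ ((i0 - i) + (i - i0))"
        by (simp add: t_def)
    qed
    also have "\<dots> = 1/20 * sum u S' + 128000 * (\<Sum>i\<in>S - {i0}. (q^4) ^ ((i0 - i) + (i - i0)))"
      by (simp add: sum.distrib sum_distrib_left S'_def)
    also have "(\<Sum>i\<in>S - {i0}. (q^4) ^ ((i0 - i) + (i - i0))) \<le> 2 * q^4 / (1 - q^4)"
      using q4 fin by (intro row_sum_le) (auto simp: q(1))
    also have "2 * q^4 / (1 - q^4) \<le> 256001 / 128000 * q^4"
    proof -
      have "2 / (1 - q^4) \<le> 256001 / 128000" using q4 by (simp add: divide_simps)
      then have "2 / (1 - q^4) * q^4 \<le> 256001 / 128000 * q^4" using q by (intro mult_right_mono) auto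
      then show ?thesis by simp
    qed
    finally show ?thesis by simp
  qed
  have row: "(\<Sum>j\<in>S'. T i0 j) \<le> 1/20 * f + 256001 * q^4"
  proof -
    have "(\<Sum>j\<in>S'. T i0 j) = (\<Sum>j\<in>S'. (\<beta> j * \<alpha> i0) powr (3/4) * (2 * q ^ ((i0 - j) + (j - i0))))"
      using S' by (intro sum.cong refl) (auto simp: T_def power_kernel_def mult.commute)
    also have "\<dots> \<le> 1/20 * sum \<beta> S' + 256001 * q^4"
      using S' nn le1 by (intro axis) auto
    finally show ?thesis by (simp add: f_def)
  qed
  have col: "(\<Sum>i\<in>S'. T i i0) \<le> 1/20 * e + 256001 * q^4"
  proof -
    have "(\<Sum>i\<in>S'. T i i0) = (\<Sum>i\<in>S'. (\<alpha> i * \<beta> i0) powr (3/4) * (2 * q ^ ((i0 - i) + (i - i0))))"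
      using S' by (intro sum.cong refl) (auto simp: T_def power_kernel_def add.commute)
    also have "\<dots> \<le> 1/20 * sum \<alpha> S' + 256001 * q^4"
      using S' nn le1 by (intro axis) auto
    finally show ?thesis by (simp add: e_def)
  qed
  have "(\<Sum>i\<in>S. \<Sum>j\<in>S. T i j)
      = T i0 i0 + (\<Sum>j\<in>S'. T i0 j) + (\<Sum>i\<in>S'. T i i0) + (\<Sum>i\<in>S'. T i i) + (\<Sum>i\<in>S'. \<Sum>j\<in>S' - {i}. T i j)"
  proof -
    have "(\<Sum>i\<in>S'. \<Sum>j\<in>S'. T i j) = (\<Sum>i\<in>S'. T i i) + (\<Sum>i\<in>S'. \<Sum>j\<in>S' - {i}. T i j)"
      using S' by (simp add: sum.distrib[symmetric] sum.remove)
    then show ?thesis using S' by (simp add: sum.distrib)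
  qed
  also have "\<dots> \<le> 1 + 512002 * q^4"
    using centre diag off row col by (simp add: field_simps)
  also have "\<dots> \<le> 1 + 10^9 * q^4" using q by simp
  finally show "(\<Sum>i\<in>S. \<Sum>j\<in>S. (\<alpha> i * \<beta> j) powr (3/4) * power_kernel q i j) \<le> 1 + 10^9 * q^4"
    unfolding T_def .
qed (use q fin in auto)

text \<open>
  A name keeps this number from being evaluated where it occurs as an exponent.
\<close>
definition prime_loss :: real where "prime_loss = 10^9"

lemma power_kernel_bound:
  assumes "0 \<le> q" "q \<le> 17/20" "finite S"
  shows "kernel_bound S (power_kernel q) (1 + prime_loss * q^4)"
  unfolding prime_loss_def using power_kernel_bound_small[of q S] power_kernel_bound_large[of q S] assms by linarith

lemma power_kernel_nonneg: "0 \<le> q \<Longrightarrow> 0 \<le> power_kernel q i j"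
  by (simp add: power_kernel_def)

section \<open>Finitely many primes\<close>

text \<open>
  The kernel acts on exponent vectors. Outside \<open>P\<close> it demands equality, which is the
  kernel with norm 1 that belongs to the primes discarded by the size of \<open>Q\<close>.
\<close>
definition exponent_kernel :: "('p \<Rightarrow> real) \<Rightarrow> 'p set \<Rightarrow> ('p \<Rightarrow> nat) \<Rightarrow> ('p \<Rightarrow> nat) \<Rightarrow> real" where
  "exponent_kernel q P e f =
     (if \<forall>p. p \<notin> P \<longrightarrow> e p = f p then \<Prod>p\<in>P. power_kernel (q p) (e p) (f p) else 0)"

text \<open>
  An exponent vector is the pair of its entry at \<open>p\<close> and of the vector with this entry set to 0. Along
  this splitting \<open>exponent_kernel q (insert p P)\<close> is a product of a kernel at \<open>p\<close> and of
  \<open>exponent_kernel q P\<close>, which compares the erased entries \<open>0 = 0\<close>.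
\<close>
lemma exponent_kernel_bound:
  assumes "finite P" "\<And>p. p \<in> P \<Longrightarrow> 0 \<le> q p \<and> q p \<le> 17/20" "finite E"
  shows "kernel_bound E (exponent_kernel q P) (\<Prod>p\<in>P. 1 + prime_loss * q p ^ 4)"
  using assms
proof (induction P arbitrary: E rule: finite_induct)
  case empty
  have "exponent_kernel q {} = (\<lambda>e f. if e = f then 1 else 0)"
    by (intro ext) (auto simp: exponent_kernel_def)
  then show ?case using kernel_bound_diagonal empty.prems(2) by simp
next
  case (insert p P)
  define split where "split e = (e p, e(p := 0))" for e :: "'a \<Rightarrow> nat"
  define S where "S = (\<lambda>e. e p) ` E"
  define E' where "E' = (\<lambda>e. e(p := 0)) ` E"
  have fin: "finite S" "finite E'" using insert.prems by (auto simp: S_def E'_def)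
  have "kernel_bound (S \<times> E')
      (\<lambda>(i, e) (j, f). power_kernel (q p) i j * exponent_kernel q P e f)
      ((1 + prime_loss * q p ^ 4) * (\<Prod>p\<in>P. 1 + prime_loss * q p ^ 4))"
  proof (rule kernel_bound_prod)
    show "kernel_bound S (power_kernel (q p)) (1 + prime_loss * q p ^ 4)"
      using insert.prems fin by (intro power_kernel_bound) auto
    show "kernel_bound E' (exponent_kernel q P) (\<Prod>p\<in>P. 1 + prime_loss * q p ^ 4)"
      using insert.prems fin by (intro insert.IH) auto
    show "0 \<le> (\<Prod>p\<in>P. 1 + prime_loss * q p ^ 4)" by (intro prod_nonneg) (auto simp: prime_loss_def)
  qed (use insert.prems in \<open>auto intro: power_kernel_nonneg\<close>)
  then have "kernel_bound E (exponent_kernel q (insert p P)) ((1 + prime_loss * q p ^ 4) * (\<Prod>p\<in>P. 1 + prime_loss * q p ^ 4))"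
  proof (rule kernel_bound_pullback)
    show "inj_on split E"
    proof (rule inj_onI)
      fix e f assume "split e = split f"
      then have "e p = f p" "e(p := 0) = f(p := 0)" by (simp_all add: split_def)
      then show "e = f" by (metis fun_upd_triv fun_upd_upd)
    qed
    show "split ` E \<subseteq> S \<times> E'" by (auto simp: split_def S_def E'_def)
    fix e f :: "'a \<Rightarrow> nat"
    have "(\<forall>r. r \<notin> insert p P \<longrightarrow> e r = f r) \<longleftrightarrow> (\<forall>r. r \<notin> P \<longrightarrow> (e(p := 0)) r = (f(p := 0)) r)"
      by auto
    moreover have "(\<Prod>r\<in>P. power_kernel (q r) ((e(p := 0)) r) ((f(p := 0)) r)) = (\<Prod>r\<in>P. power_kernel (q r) (e r) (f r))"
      using insert.hyps by (intro prod.cong) auto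
    ultimately show "exponent_kernel q (insert p P) e f =
        (case split e of (i, e) \<Rightarrow> \<lambda>(j, f). power_kernel (q p) i j * exponent_kernel q P e f) (split f)"
      unfolding exponent_kernel_def split_def using insert.hyps by (auto simp del: fun_upd_apply)
  qed (use fin in auto)
  then show ?case using insert.hyps by simp
qed

section \<open>The summand as a kernel\<close>

text \<open>
  With \<open>m = x g\<close> and \<open>n = y g\<close> for \<open>g = (m,n)\<close> the ratio is \<open>x y\<close>, and \<open>p\<close> divides
  at most one of the coprime numbers \<open>x\<close> and \<open>y\<close>.
\<close>
lemma count_prime_factorization_ratio:
  fixes m n :: nat
  assumes "0 < m" "0 < n"
  defines "e \<equiv> count (prime_factorization m)" and "f \<equiv> count (prime_factorization n)"
  shows "count (prime_factorization (m * n div (gcd m n)\<^sup>2)) p = (e p - f p) + (f p - e p)"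
proof -
  define g where "g = gcd m n"
  obtain x y where xy: "m = x * g" "n = y * g" "coprime x y"
    using gcd_coprime_exists[of m n] assms unfolding g_def by auto
  have pos: "0 < x" "0 < y" "0 < g" using xy assms by (auto intro: Nat.gr0I)
  have Q: "m * n div (gcd m n)\<^sup>2 = x * y"
  proof -
    have "m * n = (x * y) * g\<^sup>2" unfolding xy(1,2) by (simp add: power2_eq_square)
    then show ?thesis unfolding g_def[symmetric] using pos by simp
  qed
  have e: "e p = count (prime_factorization x) p + count (prime_factorization g) p"
    unfolding e_def xy(1) using pos by (simp add: prime_factorization_mult)
  have f: "f p = count (prime_factorization y) p + count (prime_factorization g) p"
    unfolding f_def xy(2) using pos by (simp add: prime_factorization_mult)
  have "p \<notin># prime_factorization x \<or> p \<notin># prime_factorization y"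
    using xy(3) by (meson coprime_common_divisor in_prime_factors_iff not_prime_unit)
  then have "count (prime_factorization x) p = 0 \<or> count (prime_factorization y) p = 0"
    by (simp add: count_eq_zero_iff)
  then show ?thesis
    unfolding Q using e f pos by (auto simp: prime_factorization_mult)
qed

lemma ratio_pos:
  fixes m n :: nat
  assumes "0 < m" "0 < n"
  shows "0 < m * n div (gcd m n)\<^sup>2" "real (m * n) = real (m * n div (gcd m n)\<^sup>2) * real (gcd m n) ^ 2"
proof -
  have dvd: "(gcd m n)\<^sup>2 dvd m * n" unfolding power2_eq_square by (intro mult_dvd_mono) auto
  show "0 < m * n div (gcd m n)\<^sup>2" using dvd assms by (simp add: div_greater_zero_iff dvd_imp_le)
  have "m * n = (m * n div (gcd m n)\<^sup>2) * (gcd m n)^2" using dvd by simp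
  then show "real (m * n) = real (m * n div (gcd m n)\<^sup>2) * real (gcd m n) ^ 2"
    by (metis of_nat_mult of_nat_power)
qed

lemma gcd_term_eq:
  fixes m n :: nat
  assumes "0 < m" "0 < n"
  shows "real (gcd m n) powr (1/2) / real (m * n) powr (1/4) = real (m * n div (gcd m n)\<^sup>2) powr (-1/4)"
proof -
  define Q where "Q = real (m * n div (gcd m n)\<^sup>2)"
  define g where "g = real (gcd m n)"
  have "0 < Q" "0 < g" using ratio_pos[OF assms] assms by (simp_all add: Q_def g_def)
  then have "g powr (1/2) / (Q * g ^ 2) powr (1/4) = Q powr (-1/4)"
    by (simp add: powr_mult powr_minus_divide powr_powr flip: powr_numeral)
  then show ?thesis unfolding ratio_pos(2)[OF assms] Q_def g_def by simp
qed

lemma powr_prime_factorization: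
  fixes n :: nat and a :: real
  assumes "0 < n"
  shows "real n powr a = (\<Prod>p\<in>prime_factors n. (real p powr a) ^ count (prime_factorization n) p)"
proof -
  have "real n = (\<Prod>p\<in>prime_factors n. real p ^ count (prime_factorization n) p)"
    using prod_mset_prime_factorization_nat[of n] assms
    by (metis (no_types, lifting) prod_mset_multiplicity of_nat_prod of_nat_power prod.cong)
  then have "real n powr a = (\<Prod>p\<in>prime_factors n. (real p ^ count (prime_factorization n) p) powr a)"
    by (simp add: prod_powr_distrib)
  also have "\<dots> = (\<Prod>p\<in>prime_factors n. (real p powr a) ^ count (prime_factorization n) p)"
  proof (rule prod.cong[OF refl])
    fix p assume "p \<in> prime_factors n"
    then have "0 < real p" by (auto simp: prime_gt_0_nat in_prime_factors_iff)
    then show "(real p ^ count (prime_factorization n) p) powr a = (real p powr a) ^ count (prime_factorization n) p"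
      by (simp add: powr_power powr_powr mult.commute flip: powr_realpow)
  qed
  finally show ?thesis .
qed

lemma twisted_term_eq_exponent_kernel:
  fixes m n :: nat
  assumes "0 < m" "0 < n" and fin: "finite P" and P: "prime_factors (m * n div (gcd m n)\<^sup>2) \<subseteq> P"
  shows "real (gcd m n) powr (1/2) / real (m * n) powr (1/4) * 2 ^ primeomega (m * n div (gcd m n)\<^sup>2)
    = exponent_kernel (\<lambda>p. real p powr (-1/4)) P (count (prime_factorization m)) (count (prime_factorization n))"
proof -
  define Q where "Q = m * n div (gcd m n)\<^sup>2"
  define e where "e = count (prime_factorization m)"
  define f where "f = count (prime_factorization n)"
  have cQ: "count (prime_factorization Q) p = (e p - f p) + (f p - e p)" for p
    unfolding Q_def e_def f_def using assms by (intro count_prime_factorization_ratio)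
  have ef: "p \<in> prime_factors Q \<longleftrightarrow> e p \<noteq> f p" for p
    using cQ[of p] count_greater_zero_iff[of "prime_factorization Q" p] by linarith
  have "real (gcd m n) powr (1/2) / real (m * n) powr (1/4) * 2 ^ primeomega Q
     = real Q powr (-1/4) * (\<Prod>p\<in>prime_factors Q. 2)"
    unfolding gcd_term_eq[OF assms(1,2)] by (simp add: Q_def primeomega_def)
  also have "\<dots> = (\<Prod>p\<in>prime_factors Q. 2 * (real p powr (-1/4)) ^ count (prime_factorization Q) p)"
    using ratio_pos(1)[OF assms(1,2)]
    by (subst powr_prime_factorization) (auto simp: Q_def prod.distrib)
  also have "\<dots> = (\<Prod>p\<in>prime_factors Q. power_kernel (real p powr (-1/4)) (e p) (f p))"
    using ef by (intro prod.cong refl) (auto simp: power_kernel_def cQ)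
  also have "\<dots> = (\<Prod>p\<in>P. power_kernel (real p powr (-1/4)) (e p) (f p))"
    using fin P ef by (intro prod.mono_neutral_left) (auto simp: power_kernel_def Q_def)
  also have "\<dots> = exponent_kernel (\<lambda>p. real p powr (-1/4)) P e f"
    using P ef unfolding exponent_kernel_def Q_def by auto
  finally show ?thesis by (simp add: Q_def e_def f_def)
qed

section \<open>Pairs with a large ratio\<close>

text \<open>
  A prime factor \<open>p \<ge> 256\<close> satisfies \<open>2 \<le> p powr (1/8)\<close>, and fewer than 256 prime factors are
  smaller.
\<close>
lemma two_power_omega_le:
  assumes "0 < n"
  shows "2 ^ primeomega n \<le> 2 ^ 256 * real n powr (1/8)"
proof -
  define F where "F = prime_factors n"
  have fin: "finite F" by (simp add: F_def)
  have p1: "1 \<le> real p" if "p \<in> F" for p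
    using that by (auto simp: F_def in_prime_factors_iff dest: prime_ge_1_nat)
  have "(2::real) ^ primeomega n = (\<Prod>p\<in>F. 2)" by (simp add: primeomega_def F_def)
  also have "\<dots> \<le> (\<Prod>p\<in>F. (if p < 256 then 2 else 1) * real p powr (1/8))"
  proof (intro prod_mono conjI)
    fix p assume "p \<in> F"
    show "2 \<le> (if p < 256 then 2 else 1) * real p powr (1/8)"
    proof (cases "p < 256")
      case True
      then show ?thesis using p1[OF \<open>p \<in> F\<close>] ge_one_powr_ge_zero[of "real p" "1/8"] by simp
    next
      case False
      have "(2::real) = (2 powr 8) powr (1/8)" by (simp add: powr_powr del: powr_numeral)
      also have "\<dots> = 256 powr (1/8)" by simp
      also have "\<dots> \<le> real p powr (1/8)" using False by (intro powr_mono2) auto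
      finally show ?thesis using False by simp
    qed
  qed simp
  also have "\<dots> = (\<Prod>p\<in>F. if p < 256 then 2 else 1) * (\<Prod>p\<in>F. real p powr (1/8))"
    by (simp add: prod.distrib)
  also have "(\<Prod>p\<in>F. if p < 256 then 2 else (1::real)) = 2 ^ card (F \<inter> {..<256})"
    using fin by (simp add: prod.If_cases lessThan_def)
  also have "\<dots> * (\<Prod>p\<in>F. real p powr (1/8)) \<le> 2 ^ 256 * real n powr (1/8)"
  proof (rule mult_mono)
    have "card (F \<inter> {..<256}) \<le> card {..<256::nat}" by (intro card_mono) auto
    then show "(2::real) ^ card (F \<inter> {..<256}) \<le> 2 ^ 256" by (intro power_increasing) auto
    have "(\<Prod>p\<in>F. real p powr (1/8)) \<le> (\<Prod>p\<in>F. (real p powr (1/8)) ^ count (prime_factorization n) p)"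
    proof (intro prod_mono conjI)
      fix p assume "p \<in> F"
      then have "1 \<le> count (prime_factorization n) p" by (simp add: F_def Suc_le_eq)
      moreover have "1 \<le> real p powr (1/8)" using p1[OF \<open>p \<in> F\<close>] by (intro ge_one_powr_ge_zero) auto
      ultimately show "real p powr (1/8) \<le> (real p powr (1/8)) ^ count (prime_factorization n) p"
        using power_increasing[of 1 _ "real p powr (1/8)"] by simp
    qed simp
    also have "\<dots> = real n powr (1/8)" using powr_prime_factorization[OF assms] by (simp add: F_def)
    finally show "(\<Prod>p\<in>F. real p powr (1/8)) \<le> real n powr (1/8)" .
  qed (auto intro: prod_nonneg)
  finally show ?thesis .
qed

text \<open>
  With \<open>Q\<close> for the ratio, \<open>Q powr (-1/4) * 2 ^ \<omega>(Q)\<close> is \<open>O(Q powr (-1/8))\<close>, and \<open>Q \<ge> N\<^sup>4\<close>.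
\<close>
lemma twisted_term_le:
  fixes m n :: nat and N :: real
  assumes "0 < m" "0 < n" "0 < N" and large: "N ^ 4 \<le> real (m * n div (gcd m n)\<^sup>2)"
  shows "real (gcd m n) powr (1/2) / real (m * n) powr (1/4) * 2 ^ primeomega (m * n div (gcd m n)\<^sup>2)
    \<le> 2 ^ 256 * N powr (-1/2)"
proof -
  define Q where "Q = m * n div (gcd m n)\<^sup>2"
  have Q: "0 < Q" unfolding Q_def by (rule ratio_pos[OF assms(1,2)])
  have "real Q powr (-1/4) * 2 ^ primeomega Q \<le> real Q powr (-1/4) * (2 ^ 256 * real Q powr (1/8))"
    by (intro mult_left_mono two_power_omega_le Q) auto
  also have "\<dots> = 2 ^ 256 * real Q powr (-1/8)" by (simp add: powr_add[symmetric])
  also have "\<dots> \<le> 2 ^ 256 * (N ^ 4) powr (-1/8)"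
    using large assms(3) by (intro mult_left_mono powr_mono2') (auto simp: Q_def)
  also have "(N ^ 4) powr (-1/8) = (N powr 4) powr (-1/8)" using assms(3) by (subst powr_numeral) auto
  also have "\<dots> = N powr (-1/2)" by (simp add: powr_powr del: powr_numeral)
  finally show ?thesis unfolding gcd_term_eq[OF assms(1,2)] Q_def .
qed

section \<open>Reciprocals of primes\<close>

lemma prod_primes_dvd:
  fixes n :: nat
  assumes "finite S" "\<And>p. p \<in> S \<Longrightarrow> prime p" "\<And>p. p \<in> S \<Longrightarrow> p dvd n"
  shows "(\<Prod>p\<in>S. p) dvd n"
  using assms
proof (induction S rule: finite_induct)
  case (insert p S)
  have "coprime p (\<Prod>p\<in>S. p)"
    using insert.hyps insert.prems by (intro prod_coprime_right primes_coprime) auto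
  then have "p * (\<Prod>p\<in>S. p) dvd n" using insert by (intro divides_mult) auto
  then show ?case using insert.hyps by simp
qed simp

text \<open>
  With \<open>n = 2 ^ k\<close>, the primes between \<open>n\<close> and \<open>2 n\<close> all divide the central binomial coefficient,
  which is at most \<open>2 ^ (2 n)\<close>, while each of them exceeds \<open>2 ^ k\<close>.
\<close>
lemma card_primes_dyadic:
  "k * card {p::nat. prime p \<and> 2^k < p \<and> p \<le> 2^(k+1)} \<le> 2^(k+1)"
proof -
  define n :: nat where "n = 2^k"
  define S where "S = {p::nat. prime p \<and> n < p \<and> p \<le> 2 * n}"
  have fin: "finite S" unfolding S_def by (rule finite_subset[of _ "{..2*n}"]) auto
  have "p dvd (2 * n) choose n" if "p \<in> S" for p
  proof -
    have p: "prime p" "n < p" "p \<le> 2 * n" using that by (auto simp: S_def)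
    have "p dvd fact (2 * n)" using p by (simp add: prime_dvd_fact_iff)
    also have "fact (2 * n) = fact n * fact n * ((2 * n) choose n)"
      using binomial_fact_lemma[of n "2 * n"] by simp
    finally have "p dvd fact n * fact n * ((2 * n) choose n)" .
    moreover have "\<not> p dvd fact n" using p by (simp add: prime_dvd_fact_iff)
    ultimately show ?thesis using p(1) by (auto simp: prime_dvd_mult_iff)
  qed
  then have "(\<Prod>p\<in>S. p) dvd (2 * n) choose n"
    by (intro prod_primes_dvd fin) (auto simp: S_def)
  then have "(\<Prod>p\<in>S. p) \<le> (2 * n) choose n" by (rule dvd_imp_le) simp
  moreover have "n ^ card S \<le> (\<Prod>p\<in>S. p)"
    using prod_mono[of S "\<lambda>_. n" "\<lambda>p. p"] by (auto simp: S_def)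
  moreover have "(2 * n) choose n \<le> 2 ^ (2 * n)" by (rule binomial_le_pow2)
  ultimately have "n ^ card S \<le> 2 ^ (2 * n)" by linarith
  then have "(2::nat) ^ (k * card S) \<le> 2 ^ (2 * n)" by (simp add: n_def power_mult)
  then have "k * card S \<le> 2 * n" by (subst (asm) power_increasing_iff) auto
  then show ?thesis by (simp add: S_def n_def)
qed

definition primes_to :: "nat \<Rightarrow> nat set" where
  "primes_to k = {p. prime p \<and> p \<le> 2 ^ k}"

lemma finite_primes_to: "finite (primes_to k)"
  unfolding primes_to_def by (rule finite_subset[of _ "{..2^k}"]) auto

text \<open>
  The dyadic block above \<open>2 ^ k\<close> contributes at most \<open>2 / k\<close>, and
  \<open>2 / k \<le> 4 / (k + 1) \<le> 4 * (ln (k + 1) - ln k)\<close>, so the sum telescopes.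
\<close>
lemma sum_inverse_primes_le:
  assumes "1 \<le> k"
  shows "(\<Sum>p\<in>primes_to k. 1 / real p) \<le> 1 + 4 * ln (real k)"
  using assms
proof (induction k rule: dec_induct)
  case base
  have "primes_to 1 = {2}"
    unfolding primes_to_def by (auto dest: prime_ge_2_nat)
  then show ?case by simp
next
  case (step k)
  define D where "D = {p::nat. prime p \<and> 2^k < p \<and> p \<le> 2^(k+1)}"
  have k: "0 < real k" using step by simp
  have split: "primes_to (Suc k) = primes_to k \<union> D"
    unfolding primes_to_def D_def by (auto intro: order.trans)
  have D: "finite D" "primes_to k \<inter> D = {}"
    using finite_primes_to[of "Suc k"] split by (auto simp: primes_to_def D_def)
  have "(\<Sum>p\<in>D. 1 / real p) \<le> (\<Sum>p\<in>D. 1 / 2^k)"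
  proof (rule sum_mono)
    fix p assume "p \<in> D"
    then have "real (2^k) \<le> real p" unfolding D_def by (subst of_nat_le_iff) auto
    then show "1 / real p \<le> 1 / 2^k" by (intro frac_le) auto
  qed
  also have "\<dots> = real (card D) / 2^k" by simp
  also have "\<dots> \<le> 2 / real k"
  proof -
    have "real (k * card D) \<le> real (2^(k+1))"
      using card_primes_dyadic[of k] unfolding D_def by (subst of_nat_le_iff) simp
    then show ?thesis using k by (simp add: field_simps)
  qed
  also have "\<dots> \<le> 4 / (real k + 1)" using step by (simp add: field_simps)
  also have "\<dots> \<le> 4 * (ln (real (Suc k)) - ln (real k))"
  proof -
    have "ln (real k / (real k + 1)) \<le> real k / (real k + 1) - 1" using k by (intro ln_le_minus_one) simp
    also have "real k / (real k + 1) - 1 = - (1 / (real k + 1))" using k by (simp add: field_simps)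
    finally show ?thesis using k by (simp add: ln_div add.commute)
  qed
  finally have "(\<Sum>p\<in>D. 1 / real p) \<le> 4 * (ln (real (Suc k)) - ln (real k))" .
  moreover have "(\<Sum>p\<in>primes_to (Suc k). 1 / real p) = (\<Sum>p\<in>primes_to k. 1 / real p) + (\<Sum>p\<in>D. 1 / real p)"
    unfolding split using D finite_primes_to by (intro sum.union_disjoint)
  ultimately show ?case using step.IH by simp
qed

lemma prod_primes_le:
  assumes "1 \<le> k" "0 \<le> c"
  shows "(\<Prod>p\<in>primes_to k. 1 + c / real p) \<le> exp c * real k powr (4 * c)"
proof -
  have "(\<Prod>p\<in>primes_to k. 1 + c / real p) \<le> (\<Prod>p\<in>primes_to k. exp (c * (1 / real p)))"
    using assms by (intro prod_mono) (auto intro!: add_nonneg_nonneg)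
  also have "\<dots> = exp (c * (\<Sum>p\<in>primes_to k. 1 / real p))"
    by (simp add: exp_sum[OF finite_primes_to] sum_distrib_left)
  also have "\<dots> \<le> exp (c * (1 + 4 * ln (real k)))"
    using assms sum_inverse_primes_le by (auto intro: mult_left_mono)
  also have "\<dots> = exp c * real k powr (4 * c)"
    using assms by (simp add: powr_def exp_add[symmetric] algebra_simps)
  finally show ?thesis .
qed

lemma prime_powr_quarter:
  fixes p :: nat
  assumes "prime p"
  shows "real p powr (-1/4) \<le> 17/20" "(real p powr (-1/4)) ^ 4 = 1 / real p"
proof -
  have p: "2 \<le> p" using assms by (rule prime_ge_2_nat)
  show 4: "(real p powr (-1/4)) ^ 4 = 1 / real p"
  proof -
    have "(real p powr (-1/4)) ^ 4 = real p powr (-1)" using p by (simp add: powr_power)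
    then show ?thesis using p by (simp add: powr_minus_divide)
  qed
  have "(real p powr (-1/4)) ^ 4 \<le> (17/20) ^ 4"
    unfolding 4 using p by (simp add: power_divide field_simps)
  then show "real p powr (-1/4) \<le> 17/20" by (rule power_le_imp_le_base[of _ 3, simplified]) auto
qed

section \<open>The GCD sum\<close>

text \<open>
  A summand whose ratio is at most \<open>2 ^ k\<close> is an entry of the kernel that belongs to the primes up to \<open>2 ^ k\<close>;
  any other summand is at most \<open>2 ^ 256 * N powr (-1/2)\<close>. Adding the two bounds for every pair
  avoids splitting the sum, since both are nonnegative.
\<close>
lemma twisted_gcd_sum_le:
  fixes M :: "nat set" and k :: nat
  assumes M: "finite M" "\<And>m. m \<in> M \<Longrightarrow> 0 < m" "M \<noteq> {}"
    and k: "1 \<le> k" "real (card M) ^ 4 \<le> 2 ^ k"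
  shows "(\<Sum>m\<in>M. \<Sum>n\<in>M.
        real (gcd m n) powr (1/2) / real (m * n) powr (1/4)
          * 2 ^ primeomega (m * n div (gcd m n)\<^sup>2))
     \<le> (exp prime_loss * real k powr (4 * prime_loss) + 2 ^ 256) * real (card M) powr (3/2)"
proof -
  define N where "N = real (card M)"
  define q where "q p = real p powr (-1/4)" for p :: nat
  define G where "G m n = real (gcd m n) powr (1/2) / real (m * n) powr (1/4)
          * 2 ^ primeomega (m * n div (gcd m n)\<^sup>2)" for m n
  define E where "E m n = exponent_kernel q (primes_to k)
          (count (prime_factorization m)) (count (prime_factorization n))" for m n
  have N: "0 < N" using M by (simp add: N_def card_gt_0_iff)
  have E_nonneg: "0 \<le> E m n" for m n
    unfolding E_def exponent_kernel_def by (auto intro!: prod_nonneg power_kernel_nonneg simp: q_def)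
  have "kernel_bound M E (\<Prod>p\<in>primes_to k. 1 + prime_loss * q p ^ 4)"
  proof (rule kernel_bound_pullback)
    show "kernel_bound ((\<lambda>m. count (prime_factorization m)) ` M) (exponent_kernel q (primes_to k))
        (\<Prod>p\<in>primes_to k. 1 + prime_loss * q p ^ 4)"
      using M finite_primes_to by (intro exponent_kernel_bound)
        (use prime_powr_quarter(1) in \<open>auto simp: q_def primes_to_def\<close>)
    show "inj_on (\<lambda>m. count (prime_factorization m)) M"
      by (rule inj_onI) (metis M(2) count_inject prod_mset_prime_factorization_nat)
  qed (use M in \<open>auto simp: E_def\<close>)
  then have "(\<Sum>m\<in>M. \<Sum>n\<in>M. (1 * 1) powr (3/4) * E m n)
      \<le> (\<Prod>p\<in>primes_to k. 1 + prime_loss * q p ^ 4) * ((\<Sum>m\<in>M. 1) * (\<Sum>m\<in>M. 1)) powr (3/4)"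
    by (rule kernel_boundD) auto
  also have "(\<Prod>p\<in>primes_to k. 1 + prime_loss * q p ^ 4) = (\<Prod>p\<in>primes_to k. 1 + prime_loss / real p)"
  proof (intro prod.cong refl)
    fix p assume "p \<in> primes_to k"
    then have "q p ^ 4 = 1 / real p"
      unfolding q_def by (intro prime_powr_quarter(2)) (simp add: primes_to_def)
    then show "1 + prime_loss * q p ^ 4 = 1 + prime_loss / real p" by simp
  qed
  also have "((\<Sum>m\<in>M. 1) * (\<Sum>m\<in>M. 1)) powr (3/4) = N powr (3/2)"
    using N by (simp add: N_def powr_mult powr_add[symmetric])
  also have "(\<Prod>p\<in>primes_to k. 1 + prime_loss / real p) * N powr (3/2)
      \<le> exp prime_loss * real k powr (4 * prime_loss) * N powr (3/2)"
    using k by (intro mult_right_mono prod_primes_le) (auto simp: prime_loss_def)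
  finally have small: "(\<Sum>m\<in>M. \<Sum>n\<in>M. E m n) \<le> exp prime_loss * real k powr (4 * prime_loss) * N powr (3/2)"
    by simp
  have "G m n \<le> E m n + 2 ^ 256 * N powr (-1/2)" if mn: "m \<in> M" "n \<in> M" for m n
  proof (cases "m * n div (gcd m n)\<^sup>2 \<le> 2 ^ k")
    case True
    have pos: "0 < m * n div (gcd m n)\<^sup>2" by (intro ratio_pos M mn)
    have "prime_factors (m * n div (gcd m n)\<^sup>2) \<subseteq> primes_to k"
    proof
      fix p assume "p \<in> prime_factors (m * n div (gcd m n)\<^sup>2)"
      then have "prime p" "p dvd m * n div (gcd m n)\<^sup>2" by auto
      then have "prime p" "p \<le> 2 ^ k" using dvd_imp_le[OF _ pos] True order.trans by blast+
      then show "p \<in> primes_to k" by (simp add: primes_to_def)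
    qed
    then have "G m n = E m n"
      unfolding G_def E_def q_def using M mn finite_primes_to by (intro twisted_term_eq_exponent_kernel) auto
    then show ?thesis by simp
  next
    case False
    then have "real (2 ^ k) \<le> real (m * n div (gcd m n)\<^sup>2)" by (subst of_nat_le_iff) simp
    then have "N ^ 4 \<le> real (m * n div (gcd m n)\<^sup>2)"
      using order.trans[OF k(2)] unfolding N_def of_nat_power of_nat_numeral by blast
    then have "G m n \<le> 2 ^ 256 * N powr (-1/2)"
      unfolding G_def using M mn N by (intro twisted_term_le) auto
    then show ?thesis using E_nonneg[of m n] by simp
  qed
  then have "(\<Sum>m\<in>M. \<Sum>n\<in>M. G m n) \<le> (\<Sum>m\<in>M. \<Sum>n\<in>M. E m n + 2 ^ 256 * N powr (-1/2))"
    by (intro sum_mono)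
  also have "\<dots> = (\<Sum>m\<in>M. \<Sum>n\<in>M. E m n) + 2 ^ 256 * (N powr 1 * N powr 1 * N powr (-1/2))"
    using N by (simp add: sum.distrib flip: N_def)
  also have "N powr 1 * N powr 1 * N powr (-1/2) = N powr (3/2)" unfolding powr_add[symmetric] by simp
  finally have "(\<Sum>m\<in>M. \<Sum>n\<in>M. G m n)
      \<le> (exp prime_loss * real k powr (4 * prime_loss) + 2 ^ 256) * N powr (3/2)"
    using small by (simp add: distrib_right)
  then show ?thesis unfolding G_def N_def .
qed

theorem lemma6:
  "\<exists>b4::real. b4 > 0 \<and> (\<exists>N0::nat. \<forall>M::nat set.
     finite M \<longrightarrow> (\<forall>m\<in>M. m > 0) \<longrightarrow> card M > N0 \<longrightarrow>
     (\<Sum>m\<in>M. \<Sum>n\<in>M.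
        real (gcd m n) powr (1/2) / real (m * n) powr (1/4)
          * 2 ^ primeomega (m * n div (gcd m n)\<^sup>2))
       \<le> real (card M) powr (3/2) * ln (real (card M)) powr b4)"
proof -
  have prime_loss: "0 \<le> prime_loss" by (simp add: prime_loss_def)
  define b where "b = 4 * prime_loss + 1"
  define A where "A = exp prime_loss * 9 powr (4 * prime_loss) + 2 ^ 256"
  have A: "1 \<le> A" unfolding A_def by (rule order.trans[of _ "2 ^ 256"]) auto
  show ?thesis
  proof (intro exI[of _ b] conjI exI[of _ "nat \<lceil>exp A\<rceil>"] allI impI)
    show "0 < b" using prime_loss by (simp add: b_def)
    fix M :: "nat set"
    assume M: "finite M" "\<forall>m\<in>M. 0 < m" and large: "nat \<lceil>exp A\<rceil> < card M"
    define N where "N = real (card M)"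
    define L where "L = ln N"
    \<comment> \<open>As \<open>ln 2 \<ge> 1/2\<close>, the factor 8 ensures \<open>N\<^sup>4 \<le> 2 ^ k\<close>.\<close>
    define k where "k = nat \<lceil>8 * L\<rceil>"
    have "exp A < N" using large unfolding N_def by linarith
    then have N: "0 < N" and L: "A \<le> L"
      using exp_gt_zero[of A] unfolding L_def by (simp_all add: ln_ge_iff del: exp_gt_zero)
    have k: "8 * L \<le> real k" "real k \<le> 9 * L" "1 \<le> k" using L A unfolding k_def by linarith+
    have "N ^ 4 = exp (4 * L)" using N by (simp add: L_def exp_of_nat_mult[of 4, simplified])
    also have "\<dots> \<le> exp (ln 2 * real k)"
    proof -
      have "1/2 \<le> ln (2::real)" using ln_le_minus_one[of "1/2::real"] by (simp add: ln_div)
      then have "1/2 * real k \<le> ln 2 * real k" by (intro mult_right_mono) auto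
      then have "4 * L \<le> ln 2 * real k" using k by linarith
      then show ?thesis by simp
    qed
    also have "\<dots> = 2 ^ k" by (simp add: exp_of_nat2_mult)
    finally have "real (card M) ^ 4 \<le> 2 ^ k" by (simp add: N_def)
    then have "(\<Sum>m\<in>M. \<Sum>n\<in>M. real (gcd m n) powr (1/2) / real (m * n) powr (1/4)
          * 2 ^ primeomega (m * n div (gcd m n)\<^sup>2))
        \<le> (exp prime_loss * real k powr (4 * prime_loss) + 2 ^ 256) * N powr (3/2)"
      unfolding N_def using M N k(3) by (intro twisted_gcd_sum_le) (auto simp: N_def)
    also have "exp prime_loss * real k powr (4 * prime_loss) + 2 ^ 256 \<le> L powr b"
    proof -
      have "1 \<le> L powr (4 * prime_loss)" using L A prime_loss by (intro ge_one_powr_ge_zero) auto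
      then have one: "2 ^ 256 * 1 \<le> 2 ^ 256 * L powr (4 * prime_loss)" by (intro mult_left_mono) auto
      have "real k powr (4 * prime_loss) \<le> (9 * L) powr (4 * prime_loss)"
        using k prime_loss by (intro powr_mono2) auto
      also have "\<dots> = 9 powr (4 * prime_loss) * L powr (4 * prime_loss)" using L A by (simp add: powr_mult)
      finally have "exp prime_loss * real k powr (4 * prime_loss) \<le> exp prime_loss * (9 powr (4 * prime_loss) * L powr (4 * prime_loss))"
        by (intro mult_left_mono) auto
      then have "exp prime_loss * real k powr (4 * prime_loss) + 2 ^ 256 \<le> A * L powr (4 * prime_loss)"
        using one unfolding A_def distrib_right mult.assoc mult_1_right by (rule add_mono)
      \<comment> \<open>One more power of \<open>ln N\<close> absorbs the constant factor, as \<open>N\<close> is large.\<close>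
      also have "\<dots> \<le> L * L powr (4 * prime_loss)" using L by (rule mult_right_mono) simp
      also have "\<dots> = L powr b" using L A unfolding b_def powr_add by simp
      finally show ?thesis .
    qed
    then have "(exp prime_loss * real k powr (4 * prime_loss) + 2 ^ 256) * N powr (3/2) \<le> L powr b * N powr (3/2)"
      by (intro mult_right_mono) auto
    finally show "(\<Sum>m\<in>M. \<Sum>n\<in>M. real (gcd m n) powr (1/2) / real (m * n) powr (1/4)
          * 2 ^ primeomega (m * n div (gcd m n)\<^sup>2))
       \<le> real (card M) powr (3/2) * ln (real (card M)) powr b"
      unfolding L_def N_def by (simp only: mult.commute)
  qed
qed

end
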